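(* Let $p\ge 29$ be a prime, $G=D_{2p}$, and $\hat{l}=2\lfloor\sqrt{2p}-\tfrac12\rfloor-1$. (i) If $\lfloor 2\sqrt{2p}\rfloor$ is even, then $\tilde{l}=\hat{l}+1$. (ii) If $\lfloor 2\sqrt{2p}\rfloor$ is odd, then $\tilde{l}=\hat{l}$ or $\tilde{l}=\hat{l}+1$.
   Context: $D_{2p}=\langle x,y\mid x^p=y^2=1,\ y^{-1}xy=x^{-1}\rangle$. A Cayley subset of $G$ is a subset $S\subset G\setminus\{1\}$ with $S=S^{-1}$ generating $G$. The Cayley graph $X(S)$ has vertex set $G$, $g,h$ adjacent iff $g^{-1}h\in S$. A connected $k$-regular graph is Ramanujan if $\mu\le 2\sqrt{k-1}$, $\mu$ being the maximum of $|\lambda|$ over adjacency eigenvalues with $|\lambda|\ne k$. Let $\widetilde{\mathcal{S}}$ be the set of all Cayley subsets of $G$, $\widetilde{\mathcal{L}}=\{2p-|S|:S\in\widetilde{\mathcal{S}}\}$, and $\tilde{l}=\max\{l\in\widetilde{\mathcal{L}}:\ X(S)$ is Ramanujan for every $S\in\widetilde{\mathcal{S}}$ with $1\le 2p-|S|\le l\}$. *)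

theory Defs
  imports
    "HOL-Algebra.Generated_Groups"
    "HOL-Computational_Algebra.Primes"
    "Graph_Theory.Digraph_Component"
    "Jordan_Normal_Form.Char_Poly"
begin

text \<open>
  The pair \<open>(a, b)\<close> encodes the normal form \<open>x\<^sup>a y\<^sup>b\<close> (with \<open>b\<close> read as an exponent
  modulo 2) in the group with presentation
  \<open>\<langle>x, y | x\<^sup>n = y\<^sup>2 = 1, y\<^sup>-\<^sup>1 x y = x\<^sup>-\<^sup>1\<rangle>\<close>.
\<close>

definition dihedral_group :: "nat \<Rightarrow> (int \<times> bool) monoid" where
  "dihedral_group n =
     \<lparr>carrier = {0..<int n} \<times> UNIV,
      monoid.mult = (\<lambda>(a, b) (c, d). ((if b then a - c else a + c) mod int n, b \<noteq> d)),
      one = (0, False)\<rparr>"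

definition cayley_subsets :: "('a, 'b) monoid_scheme \<Rightarrow> 'a set set" where
  "cayley_subsets G =
     {S. S \<subseteq> carrier G - {\<one>\<^bsub>G\<^esub>} \<and> S = m_inv G ` S \<and> generate G S = carrier G}"

text \<open>An undirected graph is represented, as usual in the graph library, by a symmetric digraph.\<close>

definition cayley_graph :: "('a, 'b) monoid_scheme \<Rightarrow> 'a set \<Rightarrow> 'a pair_pre_digraph" where
  "cayley_graph G S =
     \<lparr>pverts = carrier G,
      parcs = {(g, h). g \<in> carrier G \<and> h \<in> carrier G \<and> inv\<^bsub>G\<^esub> g \<otimes>\<^bsub>G\<^esub> h \<in> S}\<rparr>"

definition adjacency_matrix :: "'a pair_pre_digraph \<Rightarrow> 'a list \<Rightarrow> complex mat" where
  "adjacency_matrix X vs =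
     mat (length vs) (length vs) (\<lambda>(i, j). if (vs ! i, vs ! j) \<in> parcs X then 1 else 0)"

text \<open>
  The list \<open>vs\<close> is an enumeration of the vertices; different enumerations give matrices that are
  conjugate by a permutation matrix, so the spectrum does not depend on its choice.
\<close>

definition graph_spectrum :: "'a pair_pre_digraph \<Rightarrow> complex set" where
  "graph_spectrum X =
     {ev. \<exists>vs. distinct vs \<and> set vs = pverts X \<and> eigenvalue (adjacency_matrix X vs) ev}"

definition regular_graph :: "nat \<Rightarrow> 'a pair_pre_digraph \<Rightarrow> bool" where
  "regular_graph k X \<longleftrightarrow> (\<forall>v \<in> pverts X. out_degree (with_proj X) v = k)"

definition max_nontrivial_eigenvalue :: "nat \<Rightarrow> 'a pair_pre_digraph \<Rightarrow> real" where
  "max_nontrivial_eigenvalue k X =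
     Max {cmod ev | ev. ev \<in> graph_spectrum X \<and> cmod ev \<noteq> real k}"

definition ramanujan :: "'a pair_pre_digraph \<Rightarrow> bool" where
  "ramanujan X \<longleftrightarrow>
     pair_graph X \<and> Digraph_Component.connected (with_proj X) \<and>
     (\<exists>k. regular_graph k X \<and> max_nontrivial_eigenvalue k X \<le> 2 * sqrt (real k - 1))"

definition covalencies :: "nat \<Rightarrow> nat set" where
  "covalencies p = {2 * p - card S | S. S \<in> cayley_subsets (dihedral_group p)}"

definition l_tilde :: "nat \<Rightarrow> nat" where
  "l_tilde p = Max {l \<in> covalencies p.
     \<forall>S \<in> cayley_subsets (dihedral_group p).
       1 \<le> 2 * p - card S \<and> 2 * p - card S \<le> l \<longrightarrow>
       ramanujan (cayley_graph (dihedral_group p) S)}"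

definition l_hat :: "nat \<Rightarrow> int" where
  "l_hat p = 2 * \<lfloor>sqrt (2 * real p) - 1 / 2\<rfloor> - 1"

lemma group_dihedral_group:
  assumes "n > 0"
  shows "group (dihedral_group n)"
proof (rule groupI)
  fix g assume "g \<in> carrier (dihedral_group n)"
  then show "\<exists>h \<in> carrier (dihedral_group n). h \<otimes>\<^bsub>dihedral_group n\<^esub> g = \<one>\<^bsub>dihedral_group n\<^esub>"
    using assms
    by (intro bexI[of _ "(if snd g then fst g else (- fst g) mod int n, snd g)"])
       (auto simp: dihedral_group_def mod_simps)
qed (use assms in \<open>auto simp: dihedral_group_def mod_simps algebra_simps\<close>)

lemma order_dihedral_group: "Coset.order (dihedral_group n) = 2 * n"
  by (simp add: Coset.order_def dihedral_group_def card_cartesian_product)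

lemma dihedral_group_pow:
  assumes "n > 1"
  shows "(1, False) [^]\<^bsub>dihedral_group n\<^esub> k = (int k mod int n, False)"
proof (induction k)
  case 0
  then show ?case by (simp add: dihedral_group_def)
next
  case (Suc k)
  then show ?case
    using assms by (simp add: nat_pow_Suc) (simp add: dihedral_group_def mod_simps add.commute)
qed

lemma dihedral_group_presentation:
  assumes "n > 1"
  defines "G \<equiv> dihedral_group n" and "x \<equiv> (1, False)" and "y \<equiv> (0, True)"
  shows "x \<in> carrier G" "y \<in> carrier G"
    and "x [^]\<^bsub>G\<^esub> n = \<one>\<^bsub>G\<^esub>" "y [^]\<^bsub>G\<^esub> (2 :: nat) = \<one>\<^bsub>G\<^esub>"
    and "inv\<^bsub>G\<^esub> y \<otimes>\<^bsub>G\<^esub> x \<otimes>\<^bsub>G\<^esub> y = inv\<^bsub>G\<^esub> x"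
    and "generate G {x, y} = carrier G"
proof -
  interpret group G
    unfolding G_def using assms(1) by (intro group_dihedral_group) simp
  show x: "x \<in> carrier G" and y: "y \<in> carrier G"
    using assms(1) by (simp_all add: G_def x_def y_def dihedral_group_def)
  show "x [^]\<^bsub>G\<^esub> n = \<one>\<^bsub>G\<^esub>"
    unfolding G_def x_def dihedral_group_pow[OF assms(1)] by (simp add: dihedral_group_def)
  have yy: "y \<otimes>\<^bsub>G\<^esub> y = \<one>\<^bsub>G\<^esub>"
    by (simp add: G_def y_def dihedral_group_def)
  then show "y [^]\<^bsub>G\<^esub> (2 :: nat) = \<one>\<^bsub>G\<^esub>"
    using y by (simp add: numeral_2_eq_2)
  have "inv\<^bsub>G\<^esub> y = y"
    using yy y y by (rule inv_equality)
  moreover have "(y \<otimes>\<^bsub>G\<^esub> x \<otimes>\<^bsub>G\<^esub> y) \<otimes>\<^bsub>G\<^esub> x = \<one>\<^bsub>G\<^esub>"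
    using assms(1) by (simp add: G_def x_def y_def dihedral_group_def mod_simps)
  ultimately show "inv\<^bsub>G\<^esub> y \<otimes>\<^bsub>G\<^esub> x \<otimes>\<^bsub>G\<^esub> y = inv\<^bsub>G\<^esub> x"
    using x y by (metis inv_equality m_closed)
  have pow: "x [^]\<^bsub>G\<^esub> (k :: nat) \<in> generate G {x, y}" for k
    by (induction k) (auto intro: generate.intros)
  have "g \<in> generate G {x, y}" if g_in: "g \<in> carrier G" for g
  proof -
    obtain a b where g: "g = (a, b)" "0 \<le> a" "a < int n"
      using g_in by (cases g) (auto simp: G_def dihedral_group_def)
    have a: "x [^]\<^bsub>G\<^esub> nat a = (a, False)"
      unfolding G_def x_def dihedral_group_pow[OF assms(1)] using g by simp
    show ?thesis
    proof (cases b)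
      case True
      then have "g = x [^]\<^bsub>G\<^esub> nat a \<otimes>\<^bsub>G\<^esub> y"
        unfolding a using g by (simp add: G_def y_def dihedral_group_def)
      then show ?thesis
        using pow[of "nat a"] by (auto intro: generate.intros)
    next
      case False
      then show ?thesis
        using pow[of "nat a"] a g by simp
    qed
  qed
  moreover have "generate G {x, y} \<subseteq> carrier G"
    using x y by (intro generate_incl) auto
  ultimately show "generate G {x, y} = carrier G"
    by blast
qed

end

theory Submission
  imports Defs "Jordan_Normal_Form.Spectral_Radius"
begin

text \<open>
  Let \<open>S\<close> be a Cayley subset of size \<open>k\<close> with complement \<open>T\<close> of size \<open>l = 2p - k\<close>. An eigenfunction
  for an eigenvalue other than \<open>k\<close> sums to zero, so on it the adjacency operator of \<open>S\<close> is minus that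
  of \<open>T\<close>; hence \<open>|\<lambda>| \<le> l\<close>. Thus all graphs with \<open>l \<le> 2 \<surd>(2p - l - 1)\<close>, that is \<open>(l + 2)\<^sup>2 \<le> 8p\<close>, are
  Ramanujan. Conversely, for odd \<open>l < p\<close> the bound is attained: if \<open>T\<close> consists of rotations only, the
  sign character of the dihedral group has eigenvalue \<open>-l\<close>. Hence \<open>l_tilde p\<close> lies between
  \<open>\<lfloor>2 \<surd>(2p)\<rfloor> - 2\<close> and the predecessor of the first larger odd number.
\<close>

section \<open>Spectra in terms of functions on the vertices\<close>

text \<open>Indexing by \<open>nth vs\<close> is a bijection onto the vertices, so vectors
  correspond to functions on vertices. The right-hand side no longer mentions
  \<open>vs\<close>.\<close>

lemma eigenvalue_adjacency_matrix_iff: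
  assumes vs: "distinct vs" "set vs = pverts X"
  shows "eigenvalue (adjacency_matrix X vs) ev \<longleftrightarrow>
    (\<exists>f. (\<exists>g \<in> pverts X. f g \<noteq> 0) \<and>
         (\<forall>g \<in> pverts X. (\<Sum>h | h \<in> pverts X \<and> (g, h) \<in> parcs X. f h) = ev * f g))"
    (is "_ \<longleftrightarrow> (\<exists>f. ?E f)")
proof -
  let ?n = "length vs" and ?A = "adjacency_matrix X vs"
  have bij: "bij_betw (nth vs) {0..<?n} (pverts X)"
    using vs by (metis bij_betw_nth lessThan_atLeast0)
  have entry: "(?A *\<^sub>v vec ?n (\<lambda>i. f (vs ! i))) $ i =
      (\<Sum>h | h \<in> pverts X \<and> (vs ! i, h) \<in> parcs X. f h)" if "i < ?n" for f i
  proof -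
    have "(?A *\<^sub>v vec ?n (\<lambda>i. f (vs ! i))) $ i =
        (\<Sum>j = 0..<?n. if (vs ! i, vs ! j) \<in> parcs X then f (vs ! j) else 0)"
      using that by (auto simp: adjacency_matrix_def scalar_prod_def intro!: sum.cong)
    also have "\<dots> = (\<Sum>h \<in> pverts X. if (vs ! i, h) \<in> parcs X then f h else 0)"
      by (rule sum.reindex_bij_betw[OF bij])
    also have "\<dots> = (\<Sum>h | h \<in> pverts X \<and> (vs ! i, h) \<in> parcs X. f h)"
      unfolding vs(2)[symmetric] by (rule sum.inter_filter[symmetric]) simp
    finally show ?thesis .
  qed
  have vec_iff: "eigenvector ?A (vec ?n (\<lambda>i. f (vs ! i))) ev \<longleftrightarrow> ?E f" for f
  proof -
    have dim: "dim_row ?A = ?n"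
      by (simp add: adjacency_matrix_def)
    have all: "(\<forall>i < ?n. P (vs ! i)) \<longleftrightarrow> (\<forall>g \<in> pverts X. P g)" for P
      unfolding vs(2)[symmetric] by (metis in_set_conv_nth)
    have "vec ?n (\<lambda>i. f (vs ! i)) \<noteq> 0\<^sub>v ?n \<longleftrightarrow> (\<exists>g \<in> pverts X. f g \<noteq> 0)"
      using all[of "\<lambda>g. f g = 0"] by (auto simp: vec_eq_iff)
    moreover have "?A *\<^sub>v vec ?n (\<lambda>i. f (vs ! i)) = ev \<cdot>\<^sub>v vec ?n (\<lambda>i. f (vs ! i)) \<longleftrightarrow>
        (\<forall>i < ?n. (\<Sum>h | h \<in> pverts X \<and> (vs ! i, h) \<in> parcs X. f h) = ev * f (vs ! i))"
      by (subst vec_eq_iff) (auto simp: dim entry simp del: index_mult_mat_vec)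
    ultimately show ?thesis
      unfolding eigenvector_def dim
      using all[of "\<lambda>g. (\<Sum>h | h \<in> pverts X \<and> (g, h) \<in> parcs X. f h) = ev * f g"] by simp
  qed
  show ?thesis
  proof
    assume "eigenvalue ?A ev"
    then obtain v where v: "eigenvector ?A v ev"
      by (auto simp: eigenvalue_def)
    then have dim_v: "dim_vec v = ?n"
      by (auto simp: eigenvector_def adjacency_matrix_def)
    \<comment> \<open>\<open>v\<close> transported along the inverse of the enumeration. Outside the
      vertex set the value is arbitrary, but \<open>?E\<close> inspects \<open>f\<close> on vertices
      only.\<close>
    define f where "f g = v $ inv_into {0..<?n} (nth vs) g" for g
    have v_eq: "vec ?n (\<lambda>i. f (vs ! i)) = v"
    proof (rule eq_vecI)
      show "dim_vec (vec ?n (\<lambda>i. f (vs ! i))) = dim_vec v"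
        using dim_v by simp
    next
      fix i assume "i < dim_vec v"
      then show "vec ?n (\<lambda>i. f (vs ! i)) $ i = v $ i"
        using inv_into_f_f[OF bij_betw_imp_inj_on[OF bij], of i] dim_v by (simp add: f_def)
    qed
    have "?E f"
      using v unfolding v_eq[symmetric] vec_iff .
    then show "\<exists>f. ?E f"
      by (intro exI[of _ f])
  next
    assume "\<exists>f. ?E f"
    then show "eigenvalue ?A ev"
      using vec_iff unfolding eigenvalue_def by blast
  qed
qed

text \<open>The criterion is independent of the enumeration, and finiteness supplies at least one,
  so the existential over \<open>vs\<close> collapses.\<close>

lemma mem_graph_spectrum_iff:
  assumes "finite (pverts X)"
  shows "ev \<in> graph_spectrum X \<longleftrightarrow>
    (\<exists>f. (\<exists>g \<in> pverts X. f g \<noteq> 0) \<and>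
         (\<forall>g \<in> pverts X. (\<Sum>h | h \<in> pverts X \<and> (g, h) \<in> parcs X. f h) = ev * f g))"
proof -
  obtain vs where "distinct vs" "set vs = pverts X"
    using finite_distinct_list[OF assms] by blast
  then show ?thesis
    unfolding graph_spectrum_def mem_Collect_eq
    using eigenvalue_adjacency_matrix_iff[of _ X ev] by blast
qed

text \<open>A single enumeration already yields the whole spectrum. Finiteness is what makes the
  later \<open>Max\<close> meaningful.\<close>

lemma finite_graph_spectrum:
  assumes "finite (pverts X)"
  shows "finite (graph_spectrum X)"
proof -
  obtain vs where vs: "distinct vs" "set vs = pverts X"
    using finite_distinct_list[OF assms] by blast
  then have "graph_spectrum X \<subseteq> spectrum (adjacency_matrix X vs)"
    unfolding graph_spectrum_def spectrum_def
    using eigenvalue_adjacency_matrix_iff[of _ X] by blast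
  moreover have "adjacency_matrix X vs \<in> carrier_mat (length vs) (length vs)"
    by (simp add: adjacency_matrix_def)
  ultimately show ?thesis
    using card_finite_spectrum(1) finite_subset by blast
qed

section \<open>Cayley graphs of finite groups\<close>

locale finite_cayley_graph = group G for G (structure) +
  fixes S
  assumes finite_carrier: "finite (carrier G)"
    and cayley: "S \<in> cayley_subsets G"
begin

abbreviation "X \<equiv> cayley_graph G S"

lemma S_subset: "S \<subseteq> carrier G"
  and one_notin_S: "\<one> \<notin> S"
  and inv_S: "s \<in> S \<Longrightarrow> inv s \<in> S"
  and generate_S: "generate G S = carrier G"
  using cayley by (auto simp: cayley_subsets_def)

lemma finite_S: "finite S"
  using S_subset finite_carrier finite_subset by blast

lemma pverts_cayley: "pverts X = carrier G"
  by (simp add: cayley_graph_def)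

lemma mem_parcs_iff:
  "(g, h) \<in> parcs X \<longleftrightarrow> g \<in> carrier G \<and> h \<in> carrier G \<and> inv g \<otimes> h \<in> S"
  by (simp add: cayley_graph_def)

lemma inj_on_mult_left: "g \<in> carrier G \<Longrightarrow> A \<subseteq> carrier G \<Longrightarrow> inj_on (\<lambda>s. g \<otimes> s) A"
  by (rule inj_onI) (metis Units_eq Units_l_cancel subset_iff)

lemma neighbours_eq:
  assumes "g \<in> carrier G"
  shows "{h. h \<in> carrier G \<and> (g, h) \<in> parcs X} = (\<lambda>s. g \<otimes> s) ` S"
proof (intro equalityI subsetI)
  fix h assume "h \<in> {h. h \<in> carrier G \<and> (g, h) \<in> parcs X}"
  then have "inv g \<otimes> h \<in> S" "h = g \<otimes> (inv g \<otimes> h)"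
    using assms by (auto simp: mem_parcs_iff m_assoc[symmetric])
  then show "h \<in> (\<lambda>s. g \<otimes> s) ` S"
    by blast
qed (use assms S_subset in \<open>auto simp: mem_parcs_iff m_assoc[symmetric]\<close>)

lemma pair_graph_cayley: "pair_graph X"
proof
  have "parcs X \<subseteq> carrier G \<times> carrier G"
    by (auto simp: mem_parcs_iff)
  then show "finite (parcs X)"
    using finite_carrier finite_subset by blast
  show "symmetric X"
    unfolding symmetric_def
  proof (rule symI)
    fix g h assume "(g, h) \<in> arcs_ends X"
    then have *: "g \<in> carrier G" "h \<in> carrier G" "inv g \<otimes> h \<in> S"
      by (simp_all add: mem_parcs_iff)
    have "inv (inv g \<otimes> h) = inv h \<otimes> g"
      using * by (simp add: inv_mult_group)
    then show "(h, g) \<in> arcs_ends X"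
      using * inv_S by (metis mem_parcs_iff with_proj_simps(3))
  qed
  fix e assume "e \<in> parcs X"
  then show "fst e \<noteq> snd e"
    using one_notin_S by (cases e) (auto simp: mem_parcs_iff)
qed (auto simp: mem_parcs_iff pverts_cayley finite_carrier)

text \<open>Each letter of a word in \<open>S\<close> is one arc, and \<open>h\<close> is reached
  from \<open>g\<close> by spelling out \<open>inv g \<otimes> h\<close>.\<close>

lemma connected_cayley: "Digraph_Component.connected (with_proj X)"
proof -
  interpret pair_graph X
    by (rule pair_graph_cayley)
  interpret M: pair_wf_digraph "mk_symmetric (with_proj X)"
    by (rule wellformed_mk_symmetric)
  have step: "reachable (mk_symmetric (with_proj X)) h (h \<otimes> s)"
    if "h \<in> carrier G" "s \<in> S" for h s
  proof (rule M.reachable_adjI)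
    have "(h, h \<otimes> s) \<in> parcs X"
      using that S_subset by (auto simp: mem_parcs_iff m_assoc[symmetric])
    then show "(h, h \<otimes> s) \<in> parcs (mk_symmetric (with_proj X))"
      by (force simp: parcs_mk_symmetric)
  qed
  \<comment> \<open>The start vertex stays arbitrary: a product \<open>g1 \<otimes> g2\<close> is
    walked as \<open>g1\<close> from \<open>h\<close>, then \<open>g2\<close> from
    \<open>h \<otimes> g1\<close>.\<close>
  have reach: "reachable (mk_symmetric (with_proj X)) h (h \<otimes> g)"
    if "g \<in> generate G S" "h \<in> carrier G" for g h
    using that
  proof (induction arbitrary: h)
    case one
    then show ?case
      by (simp add: pverts_cayley)
  next
    case (eng g1 g2)
    have "g1 \<in> carrier G" "g2 \<in> carrier G"
      using eng.hyps generate_S by auto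
    then show ?case
      using eng.IH(1)[of h] eng.IH(2)[of "h \<otimes> g1"] eng.prems M.reachable_trans
      by (simp add: m_assoc)
  qed (use step inv_S in auto)
  have "reachable (mk_symmetric (with_proj X)) g h" if "g \<in> carrier G" "h \<in> carrier G" for g h
    using reach[of "inv g \<otimes> h" g] that by (simp add: generate_S m_assoc[symmetric])
  then show ?thesis
    unfolding Digraph_Component.connected_def
    by (intro strongly_connectedI) (auto simp: pverts_cayley)
qed

text \<open>The carrier is nonempty, so the valency is unique; this removes the existential over
  \<open>k\<close> from \<open>ramanujan\<close>.\<close>

lemma regular_graph_cayley_iff: "regular_graph k X \<longleftrightarrow> k = card S"
proof -
  have "out_degree (with_proj X) g = card S" if g: "g \<in> carrier G" for g
  proof -
    have "out_arcs (with_proj X) g = Pair g ` {h. h \<in> carrier G \<and> (g, h) \<in> parcs X}"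
      by (auto simp: out_arcs_def mem_parcs_iff)
    also have "\<dots> = Pair g ` (\<lambda>s. g \<otimes> s) ` S"
      unfolding neighbours_eq[OF g] ..
    finally show ?thesis
      unfolding out_degree_def using inj_on_mult_left[OF g S_subset] by (simp add: card_image inj_on_def)
  qed
  then show ?thesis
    unfolding regular_graph_def pverts_cayley by auto
qed

lemma ramanujan_cayley_iff:
  "ramanujan X \<longleftrightarrow> max_nontrivial_eigenvalue (card S) X \<le> 2 * sqrt (real (card S) - 1)"
  unfolding ramanujan_def regular_graph_cayley_iff
  using pair_graph_cayley connected_cayley by simp

lemma mem_spectrum_cayley_iff:
  "ev \<in> graph_spectrum X \<longleftrightarrow>
    (\<exists>f. (\<exists>g \<in> carrier G. f g \<noteq> 0) \<and> (\<forall>g \<in> carrier G. (\<Sum>s \<in> S. f (g \<otimes> s)) = ev * f g))"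
proof -
  have "(\<Sum>h | h \<in> carrier G \<and> (g, h) \<in> parcs X. f h) = (\<Sum>s \<in> S. f (g \<otimes> s))"
    if g: "g \<in> carrier G" for g and f :: "'a \<Rightarrow> complex"
    unfolding neighbours_eq[OF g]
    by (simp add: sum.reindex[OF inj_on_mult_left[OF g S_subset]])
  then show ?thesis
    using mem_graph_spectrum_iff[of X] finite_carrier by (simp add: pverts_cayley)
qed

text \<open>A multiplicative function is its own eigenfunction, since \<open>\<chi> g\<close>
  factors out of the sum over the neighbours of \<open>g\<close>.\<close>

lemma character_sum_in_spectrum:
  assumes "\<And>g h. g \<in> carrier G \<Longrightarrow> h \<in> carrier G \<Longrightarrow> \<chi> (g \<otimes> h) = \<chi> g * \<chi> h"
    and "\<chi> \<one> \<noteq> 0"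
  shows "sum \<chi> S \<in> graph_spectrum X"
  unfolding mem_spectrum_cayley_iff
proof (intro exI conjI ballI bexI)
  fix g assume "g \<in> carrier G"
  then have "(\<Sum>s \<in> S. \<chi> (g \<otimes> s)) = (\<Sum>s \<in> S. \<chi> g * \<chi> s)"
    using assms(1) S_subset by (intro sum.cong) auto
  then show "(\<Sum>s \<in> S. \<chi> (g \<otimes> s)) = sum \<chi> S * \<chi> g"
    by (simp add: sum_distrib_left mult.commute)
qed (use assms(2) in auto)

lemma norm_eigenvalue_le_covalency:
  assumes ev: "ev \<in> graph_spectrum X" and ne: "ev \<noteq> of_nat (card S)"
  shows "cmod ev \<le> real (card (carrier G - S))"
proof -
  obtain f g where g: "g \<in> carrier G" "f g \<noteq> 0"
    and eq: "\<And>g. g \<in> carrier G \<Longrightarrow> (\<Sum>s \<in> S. f (g \<otimes> s)) = ev * f g"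
    using ev unfolding mem_spectrum_cayley_iff by blast
  have right: "(\<Sum>g \<in> carrier G. f (g \<otimes> s)) = sum f (carrier G)" if "s \<in> carrier G" for s
    using sum.reindex_bij_witness[of "carrier G" "\<lambda>g. g \<otimes> inv s" "\<lambda>g. g \<otimes> s" "carrier G" f
        "\<lambda>g. f (g \<otimes> s)"] that by (simp add: m_assoc)
  have left: "(\<Sum>h \<in> carrier G. f (g \<otimes> h)) = sum f (carrier G)" if "g \<in> carrier G" for g
    using sum.reindex_bij_witness[of "carrier G" "\<lambda>h. inv g \<otimes> h" "\<lambda>h. g \<otimes> h" "carrier G" f
        "\<lambda>h. f (g \<otimes> h)"] that by (simp add: m_assoc[symmetric])
  \<comment> \<open>Right translations permute the group, so summing the eigenvalue equation over
    all vertices gives \<open>ev\<close> times the total equal to \<open>card S\<close> times the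
    total.\<close>
  have "ev * sum f (carrier G) = (\<Sum>g \<in> carrier G. \<Sum>s \<in> S. f (g \<otimes> s))"
    by (simp add: eq sum_distrib_left)
  also have "\<dots> = (\<Sum>s \<in> S. \<Sum>g \<in> carrier G. f (g \<otimes> s))"
    by (rule sum.swap)
  also have "\<dots> = (\<Sum>s \<in> S. sum f (carrier G))"
    using S_subset by (intro sum.cong[OF refl] right) auto
  finally have zero: "sum f (carrier G) = 0"
    using ne by simp
  \<comment> \<open>At a vertex where the modulus of \<open>f\<close> is maximal, every term of the
    complementary sum is at most \<open>cmod (f m)\<close>, which can then be cancelled.\<close>
  obtain m where m: "m \<in> carrier G" "\<And>h. h \<in> carrier G \<Longrightarrow> cmod (f h) \<le> cmod (f m)"
    using Max_in[of "(\<lambda>h. cmod (f h)) ` carrier G"] Max_ge[of "(\<lambda>h. cmod (f h)) ` carrier G"]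
      finite_carrier g(1) by fastforce
  have pos: "cmod (f m) > 0"
    using m(2)[OF g(1)] g(2) by (metis order_less_le_trans zero_less_norm_iff)
  have "(\<Sum>s \<in> carrier G - S. f (m \<otimes> s)) = - (ev * f m)"
    using left[OF m(1)] zero eq[OF m(1)] sum.subset_diff[OF S_subset finite_carrier, of "\<lambda>s. f (m \<otimes> s)"]
    by (simp add: eq_neg_iff_add_eq_0)
  then have "cmod ev * cmod (f m) = cmod (\<Sum>s \<in> carrier G - S. f (m \<otimes> s))"
    by (simp add: norm_mult)
  also have "\<dots> \<le> (\<Sum>s \<in> carrier G - S. cmod (f m))"
    using m by (intro sum_norm_le) auto
  also have "\<dots> = real (card (carrier G - S)) * cmod (f m)"
    by simp
  finally show ?thesis
    using pos by simp
qed

lemma finite_nontrivial_eigenvalues: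
  "finite {cmod ev | ev. ev \<in> graph_spectrum X \<and> cmod ev \<noteq> real (card S)}"
proof (rule finite_subset)
  show "finite (cmod ` graph_spectrum X)"
    using finite_graph_spectrum[of X] finite_carrier by (simp add: pverts_cayley)
qed auto

end

section \<open>Dihedral groups\<close>

lemma carrier_dihedral: "carrier (dihedral_group p) = {0..<int p} \<times> UNIV"
  by (simp add: dihedral_group_def)

lemma inv_dihedral:
  assumes "p > 0" and "0 \<le> a" "a < int p"
  shows "inv\<^bsub>dihedral_group p\<^esub> (a, b) = (if b then a else (- a) mod int p, b)"
proof -
  interpret group "dihedral_group p"
    using assms(1) by (rule group_dihedral_group)
  show ?thesis
    using assms by (intro inv_equality) (auto simp: dihedral_group_def mod_simps)
qed

text \<open>The linear character whose kernel is the rotation subgroup.\<close>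

definition sign_char :: "int \<times> bool \<Rightarrow> complex" where
  "sign_char g = (if snd g then - 1 else 1)"

lemma sum_sign_char:
  assumes "finite S"
  shows "sum sign_char S =
    of_nat (card {g \<in> S. \<not> snd g}) - of_nat (card {g \<in> S. snd g})"
proof -
  have "sum sign_char S = sum sign_char {g \<in> S. \<not> snd g} + sum sign_char {g \<in> S. snd g}"
    using assms by (subst sum.union_disjoint[symmetric]) (auto intro!: sum.cong)
  also have "\<dots> = (\<Sum>g \<in> {g \<in> S. \<not> snd g}. 1) + (\<Sum>g \<in> {g \<in> S. snd g}. - 1)"
    by (intro arg_cong2[of _ _ _ _ "(+)"] sum.cong) (auto simp: sign_char_def)
  finally show ?thesis
    by (simp add: sum_negf)
qed

locale dihedral_cayley_graph =
  fixes p :: nat and S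
  assumes p_pos: "p > 0" and S_cayley: "S \<in> cayley_subsets (dihedral_group p)"
begin

sublocale finite_cayley_graph "dihedral_group p" S
  using group_dihedral_group[OF p_pos] S_cayley
  by (simp add: finite_cayley_graph_def finite_cayley_graph_axioms_def carrier_dihedral)

lemma card_dihedral: "card (carrier (dihedral_group p)) = 2 * p"
  using order_dihedral_group[of p] by (simp add: Coset.order_def)

lemma card_S_less: "card S < 2 * p"
proof -
  have "S \<subset> carrier (dihedral_group p)"
    using S_subset one_notin_S by blast
  then show ?thesis
    using psubset_card_mono[OF finite_carrier] card_dihedral by simp
qed

lemma card_compl_S: "card (carrier (dihedral_group p) - S) = 2 * p - card S"
  using S_subset finite_S by (simp add: card_Diff_subset card_dihedral)

lemma sign_eigenvalue:
  "of_nat (card {g \<in> S. \<not> snd g}) - of_nat (card {g \<in> S. snd g}) \<in> graph_spectrum X"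
proof -
  have "sum sign_char S \<in> graph_spectrum X"
    by (rule character_sum_in_spectrum) (auto simp: sign_char_def dihedral_group_def)
  then show ?thesis
    using sum_sign_char[OF finite_S] by simp
qed

lemma card_S_split: "card S = card {g \<in> S. \<not> snd g} + card {g \<in> S. snd g}"
proof -
  have "card ({g \<in> S. \<not> snd g} \<union> {g \<in> S. snd g}) = card {g \<in> S. \<not> snd g} + card {g \<in> S. snd g}"
    using finite_S by (intro card_Un_disjoint) auto
  moreover have "{g \<in> S. \<not> snd g} \<union> {g \<in> S. snd g} = S"
    by blast
  ultimately show ?thesis
    by simp
qed

lemma card_coset_le: "card {g \<in> S. snd g = b} \<le> p"
proof -
  have "{g \<in> S. snd g = b} \<subseteq> {0..<int p} \<times> {b}"
    using S_subset by (auto simp: carrier_dihedral)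
  then have "card {g \<in> S. snd g = b} \<le> card ({0..<int p} \<times> {b})"
    by (intro card_mono) auto
  then show ?thesis
    by (simp add: card_cartesian_product)
qed

lemma ramanujan_if_covalency_small:
  assumes l: "2 * p - card S < p" and le: "(2 * p - card S + 2)\<^sup>2 \<le> 8 * p"
  shows "ramanujan X"
proof -
  define l where "l = 2 * p - card S"
  define a where "a = card {g \<in> S. \<not> snd g}"
  define b where "b = card {g \<in> S. snd g}"
  let ?E = "{cmod ev | ev. ev \<in> graph_spectrum X \<and> cmod ev \<noteq> real (card S)}"
  have ab: "card S = a + b" "a \<le> p" "b \<le> p"
    using card_S_split card_coset_le[of True] card_coset_le[of False] by (simp_all add: a_def b_def)
  \<comment> \<open>\<open>card S > p\<close>, while each coset of the rotations has only
    \<open>p\<close> elements; so \<open>S\<close> meets both, and the sign eigenvalue has modulus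
    below \<open>card S\<close>.\<close>
  then have "a > 0" "b > 0"
    using l by auto
  then have "\<bar>real a - real b\<bar> \<noteq> real (card S)"
    using ab(1) by auto
  moreover have "cmod (of_nat a - of_nat b) = \<bar>real a - real b\<bar>"
    by (metis norm_of_real of_real_diff of_real_of_nat_eq)
  \<comment> \<open>\<open>Max {}\<close> is unspecified, so a nontrivial eigenvalue has to be exhibited.\<close>
  ultimately have "?E \<noteq> {}"
    using sign_eigenvalue unfolding a_def[symmetric] b_def[symmetric] by auto
  moreover have "x \<le> real l" if "x \<in> ?E" for x
    using that norm_eigenvalue_le_covalency unfolding l_def card_compl_S by fastforce
  ultimately have "max_nontrivial_eigenvalue (card S) X \<le> real l"
    unfolding max_nontrivial_eigenvalue_def using finite_nontrivial_eigenvalues by simp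
  also have "real l \<le> 2 * sqrt (real (card S) - 1)"
  proof -
    have card: "real (card S) = 2 * real p - real l"
      using card_S_less by (simp add: l_def)
    have "real ((l + 2)\<^sup>2) \<le> real (8 * p)"
      using le unfolding l_def by (simp only: of_nat_le_iff)
    then have "(real l)\<^sup>2 \<le> 4 * (real (card S) - 1)"
      unfolding card by (simp add: power2_eq_square algebra_simps)
    then have "real l \<le> sqrt (4 * (real (card S) - 1))"
      by (rule real_le_rsqrt)
    then show ?thesis
      unfolding real_sqrt_mult by simp
  qed
  finally show ?thesis
    unfolding ramanujan_cayley_iff .
qed

text \<open>With every reflection in \<open>S\<close>, the sign eigenvalue is
  \<open>(p - l) - p = - l\<close>, so the general bound \<open>l\<close> on nontrivial eigenvalues
  is attained.\<close>

lemma not_ramanujan_if_all_reflections: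
  assumes refl: "card {g \<in> S. snd g} = p" and l: "2 * p - card S < p"
    and gr: "(2 * p - card S + 2)\<^sup>2 > 8 * p"
  shows "\<not> ramanujan X"
proof
  define l where "l = 2 * p - card S"
  let ?E = "{cmod ev | ev. ev \<in> graph_spectrum X \<and> cmod ev \<noteq> real (card S)}"
  assume "ramanujan X"
  then have le: "max_nontrivial_eigenvalue (card S) X \<le> 2 * sqrt (real (card S) - 1)"
    unfolding ramanujan_cayley_iff .
  have card: "real (card S) = 2 * real p - real l"
    using card_S_less by (simp add: l_def)
  have "real (card {g \<in> S. \<not> snd g}) = real p - real l"
    using card_S_split refl card by simp
  then have "of_nat (card {g \<in> S. \<not> snd g}) = complex_of_real (real p - real l)"
    by (metis of_real_of_nat_eq)
  then have "- of_real (real l) \<in> graph_spectrum X"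
    using sign_eigenvalue refl by simp
  \<comment> \<open>\<open>l < p < card S\<close>, so \<open>- l\<close> counts as a nontrivial
    eigenvalue.\<close>
  moreover have "real l \<noteq> real (card S)"
    using l card unfolding l_def[symmetric] by linarith
  ultimately have "real l \<in> ?E"
    by (auto intro!: exI[of _ "- complex_of_real (real l)"])
  then have "real l \<le> max_nontrivial_eigenvalue (card S) X"
    unfolding max_nontrivial_eigenvalue_def by (intro Max_ge finite_nontrivial_eigenvalues)
  also note le
  finally have "(real l)\<^sup>2 \<le> (2 * sqrt (real (card S) - 1))\<^sup>2"
    by (intro power_mono) auto
  \<comment> \<open>Squaring is exact because \<open>card S > p\<close> keeps the radicand
    nonnegative.\<close>
  also have "\<dots> = 4 * (real (card S) - 1)"
    using l by (simp add: power_mult_distrib)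
  finally have "real ((l + 2)\<^sup>2) \<le> real (8 * p)"
    unfolding card by (simp add: power2_eq_square algebra_simps)
  then show False
    using gr unfolding l_def of_nat_le_iff by simp
qed

end

section \<open>Cayley subsets of prescribed covalency\<close>

text \<open>Best read through its complement when \<open>2 * r + 1 \<le> p\<close> and
  \<open>c\<close> is 0 or 1: the rotations with exponent between \<open>-r\<close> and
  \<open>r\<close> modulo \<open>p\<close>, identity included, and \<open>c\<close>
  reflections.\<close>

definition interval_cayley_set :: "nat \<Rightarrow> nat \<Rightarrow> int \<Rightarrow> (int \<times> bool) set" where
  "interval_cayley_set p r c = {int r<..<int p - int r} \<times> {False} \<union> {c..<int p} \<times> {True}"

text \<open>The rotation interval is symmetric under negation modulo \<open>p\<close> and
  reflections are involutions, so the set is closed under inverses. At most the reflection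
  \<open>y\<close> is missing, and the remaining ones generate.\<close>

lemma interval_cayley_set_cayley:
  assumes p: "p \<ge> 3" and c: "0 \<le> c" "c \<le> 1"
  shows "interval_cayley_set p r c \<in> cayley_subsets (dihedral_group p)"
proof -
  let ?G = "dihedral_group p" and ?S = "interval_cayley_set p r c"
  interpret group ?G
    using p by (intro group_dihedral_group) simp
  have sub: "?S \<subseteq> carrier ?G - {\<one>\<^bsub>?G\<^esub>}"
    using c by (auto simp: interval_cayley_set_def dihedral_group_def)
  have inv: "inv\<^bsub>?G\<^esub> s \<in> ?S" if "s \<in> ?S" for s
  proof -
    obtain a b where s: "s = (a, b)"
      by force
    then have a: "0 \<le> a" "a < int p"
      using that c by (auto simp: interval_cayley_set_def)
    have "(- a) mod int p = int p - a" if "a > 0"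
      using that a by (simp add: zmod_zminus1_eq_if)
    then show ?thesis
      using that a p unfolding s by (auto simp: inv_dihedral interval_cayley_set_def)
  qed
  have "s \<in> m_inv ?G ` ?S" if "s \<in> ?S" for s
    using inv[OF that] sub that by (intro image_eqI[of _ _ "inv\<^bsub>?G\<^esub> s"]) auto
  then have img: "?S = m_inv ?G ` ?S"
    using inv by blast
  \<comment> \<open>\<open>x y\<close> and \<open>x\<^sup>2 y\<close> survive for either value of
    \<open>c\<close>; their product gives \<open>x\<close>, and then \<open>y\<close>
    follows.\<close>
  have gen1: "(1, True) \<in> generate ?G ?S" "(2, True) \<in> generate ?G ?S"
    using p c by (auto intro!: generate.incl simp: interval_cayley_set_def)
  have "(2, True) \<otimes>\<^bsub>?G\<^esub> (1, True) = (1, False)"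
    using p by (simp add: dihedral_group_def)
  then have x: "(1, False) \<in> generate ?G ?S"
    using generate.eng[OF gen1(2,1)] by simp
  have "(1, True) \<otimes>\<^bsub>?G\<^esub> (1, False) = (0, True)"
    by (simp add: dihedral_group_def)
  then have y: "(0, True) \<in> generate ?G ?S"
    using generate.eng[OF gen1(1) x] by simp
  have subgroup: "subgroup (generate ?G ?S) ?G"
    using sub by (intro generate_is_subgroup) auto
  have "generate ?G {(1, False), (0, True)} \<subseteq> generate ?G ?S"
    using x y by (intro generate_subgroup_incl[OF _ subgroup]) auto
  then have "carrier ?G \<subseteq> generate ?G ?S"
    using dihedral_group_presentation(6)[of p] p by simp
  then have "generate ?G ?S = carrier ?G"
    using subgroup.subset[OF subgroup] by blast
  then show ?thesis
    using sub img unfolding cayley_subsets_def by simp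
qed

lemma card_interval_cayley_set:
  assumes "2 * r + 1 \<le> p" "c \<le> 1"
  shows "card (interval_cayley_set p r (int c)) = 2 * p - (2 * r + 1 + c)"
proof -
  have "card (interval_cayley_set p r (int c)) =
      card ({int r<..<int p - int r} \<times> {False}) + card ({int c..<int p} \<times> {True})"
    unfolding interval_cayley_set_def by (intro card_Un_disjoint) auto
  also have "\<dots> = nat (int p - int r - int r - 1) + nat (int p - int c)"
    by (simp add: card_cartesian_product)
  finally show ?thesis
    using assms by (simp add: nat_diff_distrib' algebra_simps)
qed

lemma mem_covalencies:
  assumes "p \<ge> 3" and "1 \<le> l" "l \<le> p"
  shows "l \<in> covalencies p"
proof -
  \<comment> \<open>The identity and \<open>r\<close> inverse pairs of rotations account for an odd
    number of removed elements; for even \<open>l\<close> one reflection is removed as well.\<close>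
  define r c where "r = (l - 1) div 2" and "c = (l - 1) mod 2"
  have rc: "l = 2 * r + 1 + c" "c \<le> 1"
    using assms(2) by (auto simp: r_def c_def)
  have "interval_cayley_set p r (int c) \<in> cayley_subsets (dihedral_group p)"
    using rc assms(1) by (intro interval_cayley_set_cayley) auto
  moreover have "2 * p - card (interval_cayley_set p r (int c)) = l"
    using card_interval_cayley_set[of r p c] rc assms by simp
  ultimately show ?thesis
    unfolding covalencies_def by blast
qed

text \<open>An interval of rotations centred at the identity has odd size, so an odd
  \<open>l\<close> can be realised with all reflections kept (\<open>c = 0\<close>).\<close>

lemma not_ramanujan_odd_covalency:
  assumes "p \<ge> 3" and "odd l" "l < p" and gr: "(l + 2)\<^sup>2 > 8 * p"
  obtains S where "S \<in> cayley_subsets (dihedral_group p)" "2 * p - card S = l"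
    "\<not> ramanujan (cayley_graph (dihedral_group p) S)"
proof -
  obtain r where l: "l = 2 * r + 1"
    using assms(2) by (elim oddE)
  let ?S = "interval_cayley_set p r (int 0)"
  have S: "?S \<in> cayley_subsets (dihedral_group p)"
    using assms(1) by (intro interval_cayley_set_cayley) auto
  interpret dihedral_cayley_graph p ?S
    using S assms(1) by unfold_locales auto
  have card: "2 * p - card ?S = l"
    using card_interval_cayley_set[of r p 0] l assms(3) by simp
  have "{g \<in> ?S. snd g} = {0..<int p} \<times> {True}"
    by (auto simp: interval_cayley_set_def)
  then have "card {g \<in> ?S. snd g} = p"
    by (simp add: card_cartesian_product)
  then have "\<not> ramanujan (cayley_graph (dihedral_group p) ?S)"
    using card assms(3) gr by (intro not_ramanujan_if_all_reflections) simp_all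
  then show ?thesis
    using that S card by blast
qed

section \<open>Bracketing \<open>l_tilde\<close> and comparing with \<open>l_hat\<close>\<close>

text \<open>\<open>l\<close> enters the set under the maximum, being a covalency below which the
  eigenvalue bound suffices; a bad Cayley subset of covalency \<open>m\<close> excludes every
  candidate from \<open>m\<close> on.\<close>

lemma l_tilde_bounds:
  assumes p: "p \<ge> 3"
    and l: "1 \<le> l" "(l + 2)\<^sup>2 \<le> 8 * p"
    and m: "odd m" "m < p" "(m + 2)\<^sup>2 > 8 * p"
  shows "l \<le> l_tilde p" "l_tilde p < m"
proof -
  let ?L = "{l \<in> covalencies p. \<forall>S \<in> cayley_subsets (dihedral_group p).
      1 \<le> 2 * p - card S \<and> 2 * p - card S \<le> l \<longrightarrow> ramanujan (cayley_graph (dihedral_group p) S)}"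
  \<comment> \<open>Comparing squares yields \<open>l < m < p\<close>, which puts all covalencies up
    to \<open>l\<close> in the range where \<open>ramanujan_if_covalency_small\<close>
    applies.\<close>
  have "(l + 2)\<^sup>2 < (m + 2)\<^sup>2"
    using l(2) m(3) by linarith
  then have lm: "l < m"
    by (auto dest: power_less_imp_less_base)
  have "ramanujan (cayley_graph (dihedral_group p) S)"
    if S: "S \<in> cayley_subsets (dihedral_group p)" "2 * p - card S \<le> l" for S
  proof -
    interpret dihedral_cayley_graph p S
      using S p by unfold_locales auto
    have "(2 * p - card S + 2)\<^sup>2 \<le> (l + 2)\<^sup>2"
      using S(2) by (intro power_mono) auto
    then have "(2 * p - card S + 2)\<^sup>2 \<le> 8 * p"
      using l(2) by linarith
    then show ?thesis
      using S(2) lm m(2) by (intro ramanujan_if_covalency_small) linarith+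
  qed
  then have mem: "l \<in> ?L"
    using mem_covalencies[OF p, of l] l lm m by auto
  have "finite ?L"
    by (rule finite_subset[of _ "{..2 * p}"]) (auto simp: covalencies_def)
  moreover have "x < m" if "x \<in> ?L" for x
  proof (rule ccontr)
    assume "\<not> x < m"
    obtain S where "S \<in> cayley_subsets (dihedral_group p)" "2 * p - card S = m"
      "\<not> ramanujan (cayley_graph (dihedral_group p) S)"
      using not_ramanujan_odd_covalency[OF p m] .
    then show False
      using that \<open>\<not> x < m\<close> l lm by auto
  qed
  ultimately show "l \<le> l_tilde p" "l_tilde p < m"
    unfolding l_tilde_def using mem Max_ge[of ?L l] Max_in[of ?L] by blast+
qed

theorem theorem4p3:
  fixes p :: nat
  assumes "prime p" and "p \<ge> 29"
  shows "(even \<lfloor>2 * sqrt (2 * real p)\<rfloor> \<longrightarrow> int (l_tilde p) = l_hat p + 1) \<and>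
         (odd \<lfloor>2 * sqrt (2 * real p)\<rfloor> \<longrightarrow>
            int (l_tilde p) = l_hat p \<or> int (l_tilde p) = l_hat p + 1)"
proof -
  define q where "q = sqrt (2 * real p)"
  \<comment> \<open>\<open>F\<close> is the integer square root of \<open>8 * p\<close>, so
    \<open>F - 2\<close> is the largest \<open>l\<close> with
    \<open>(l + 2)\<^sup>2 \<le> 8 * p\<close>.\<close>
  define F where "F = nat \<lfloor>2 * q\<rfloor>"
  have q2: "q\<^sup>2 = 2 * real p"
    by (simp add: q_def)
  \<comment> \<open>From \<open>2 * p \<ge> 58 > 49\<close>. The resulting \<open>F \<ge> 14\<close>
    keeps the natural subtractions \<open>F - 2\<close> and \<open>F - 1\<close> exact.\<close>
  have q7: "q > 7"
    unfolding q_def using assms(2) by (intro real_less_rsqrt) auto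
  then have F: "\<lfloor>2 * q\<rfloor> = int F" "F \<ge> 14"
    unfolding F_def by linarith+
  then have Fq: "real F \<le> 2 * q" "2 * q < real F + 1"
    by linarith+
  have eight: "real (8 * p) = (2 * q)\<^sup>2"
    by (simp add: power_mult_distrib q2)
  have "real (F\<^sup>2) \<le> real (8 * p)"
    unfolding eight of_nat_power using Fq(1) by (intro power_mono) auto
  then have low: "F\<^sup>2 \<le> 8 * p"
    by (simp only: of_nat_le_iff)
  have "real (8 * p) < real ((F + 1)\<^sup>2)"
    unfolding eight using Fq(2) q7 power_strict_mono[of "2 * q" "real F + 1" 2]
    by (simp add: add.commute)
  then have up: "8 * p < (F + 1)\<^sup>2"
    by (simp only: of_nat_less_iff)
  \<comment> \<open>Otherwise \<open>F \<ge> p \<ge> 29\<close> would give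
    \<open>29 * p \<le> F\<^sup>2 \<le> 8 * p\<close>.\<close>
  have Fp: "F < p"
  proof (rule ccontr)
    assume "\<not> F < p"
    then have "29 * p \<le> F * F"
      using assms(2) by (intro mult_mono) auto
    then show False
      using low assms(2) by (simp add: power2_eq_square)
  qed
  show ?thesis
  proof (cases "even F")
    case True
    then obtain m where m: "F = 2 * m"
      by (elim evenE)
    \<comment> \<open>Here \<open>m \<le> q < m + 1/2\<close>.\<close>
    have "\<lfloor>q - 1 / 2\<rfloor> = int m - 1"
      using Fq m by (intro floor_unique) auto
    then have hat: "l_hat p = int F - 3"
      by (simp add: l_hat_def q_def m)
    have sub: "F - 2 + 2 = F" "F - 1 + 2 = F + 1"
      using F(2) by auto
    \<comment> \<open>\<open>F - 1\<close> is odd and already exceeds the threshold, so only the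
      value \<open>F - 2\<close> remains.\<close>
    have "F - 2 \<le> l_tilde p" "l_tilde p < F - 1"
      using F(2) low up Fp True assms(2)
        l_tilde_bounds[of p "F - 2" "F - 1", unfolded sub] by simp_all
    then show ?thesis
      using True F hat unfolding q_def[symmetric] by auto
  next
    case False
    then obtain m where m: "F = 2 * m + 1"
      by (elim oddE)
    \<comment> \<open>Here \<open>m + 1/2 \<le> q < m + 1\<close>.\<close>
    have "\<lfloor>q - 1 / 2\<rfloor> = int m"
      using Fq m by (intro floor_unique) auto
    then have hat: "l_hat p = int F - 2"
      by (simp add: l_hat_def q_def m)
    have "(F + 1)\<^sup>2 \<le> (F + 2)\<^sup>2"
      by (intro power_mono) auto
    then have up': "8 * p < (F + 2)\<^sup>2"
      using up by linarith
    have sub: "F - 2 + 2 = F"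
      using F(2) by auto
    \<comment> \<open>\<open>F - 1\<close> is now even, so the first odd number above the threshold
      is \<open>F\<close>; the bounds leave both \<open>F - 2\<close> and \<open>F - 1\<close>
      open.\<close>
    have "F - 2 \<le> l_tilde p" "l_tilde p < F"
      using F(2) low up' Fp False assms(2)
        l_tilde_bounds[of p "F - 2" F, unfolded sub] by simp_all
    then show ?thesis
      using False F hat unfolding q_def[symmetric] by auto
  qed
qed

end
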